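(* Let $n\ge1$. The map $\vartheta:\mathcal{RB}_n\to\mathcal{RB}_n$ is an involution that preserves the right chain sequences and switches the statistics $\mathsf{spi}$ and $\mathsf{rspi}$ (i.e. $\mathsf{spi}(\vartheta(T))=\mathsf{rspi}(T)$ and $\mathsf{rspi}(\vartheta(T))=\mathsf{spi}(T)$ for all $T\in\mathcal{RB}_n$).
   Context: A binary tree is a rooted tree in which each node has at most one left child and at most one right child. A right increasing binary tree on $[n]=\{1,\dots,n\}$ is a binary tree with $n$ nodes labeled bijectively by $[n]$ such that the label of each right child is greater than that of its parent; $\mathcal{RB}_n$ is the set of these. The preorder visits, recursively, the parent, then its left subtree, then its right subtree. The reverse preorder visits, recursively, the right subtree, then the left subtree, then the parent. The following depend only on the underlying binary tree. $\mathsf{spi}$ is the smallest $i$ such that the $(i+1)$-th node under the preorder is a right child. $\mathsf{rspi}$ is the smallest $i$ such that the $(i+1)$-th node under the reverse preorder has a right child. By convention, for a binary tree with $n$ nodes and only left edges, $\mathsf{spi}=\mathsf{rspi}=n$. A right chain is a maximal path composed only of right edges (single nodes with no incident right edge count as right chains of length $0$); its length is its number of right edges; the right chain sequence is the multiset of the lengths of all right chains. The map $\vartheta$: let $T\in\mathcal{RB}_n$ and let $v_i$ be its $i$-th node under the preorder. Then $\vartheta(T)$ is the tree on the nodes $v_1,\dots,v_n$ with root $v_n$ such that, for $i$ from $n-1$ down to $1$: if $v_i$ has right child $v_\ell$ in $T$, then $v_i$ is the right child of $v_\ell$ in $\vartheta(T)$; otherwise $v_i$ is the left child of $v_{i+1}$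 in $\vartheta(T)$. Moreover, a node is labeled $i$ in $\vartheta(T)$ iff it is labeled $n+1-i$ in $T$. *)

theory Defs
  imports "HOL-Library.Tree" "HOL-Library.Multiset" "HOL-Library.Sublist"
begin

text \<open>
  A binary tree with labelled nodes is an element of the library type \<^typ>\<open>'a tree\<close>, in which
  \<^const>\<open>Leaf\<close> stands for the empty tree (an absent child) and is not a node. In all trees
  considered here the labels are pairwise distinct, so nodes are referred to by their labels;
  the relations and statistics below are only meant for such trees.
\<close>

text \<open>In both child relations the first node is the parent and the second one the child.\<close>

definition left_child :: "'a tree \<Rightarrow> 'a \<Rightarrow> 'a \<Rightarrow> bool" where
  "left_child t v w \<longleftrightarrow> (\<exists>l r r'. Node (Node l w r) v r' \<in> subtrees t)"

definition right_child :: "'a tree \<Rightarrow> 'a \<Rightarrow> 'a \<Rightarrow> bool" where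
  "right_child t v w \<longleftrightarrow> (\<exists>l' l r. Node l' v (Node l w r) \<in> subtrees t)"

definition RB :: "nat \<Rightarrow> nat tree set" where
  "RB n = {t. set_tree t = {1..n} \<and> distinct (preorder t) \<and>
              (\<forall>v w. right_child t v w \<longrightarrow> v < w)}"

fun rev_preorder :: "'a tree \<Rightarrow> 'a list" where
  "rev_preorder Leaf = []"
| "rev_preorder (Node l x r) = rev_preorder r @ rev_preorder l @ [x]"

text \<open>List positions start at \<open>0\<close>, so \<open>preorder t ! i\<close> is the \<open>(i+1)\<close>-th node.\<close>

definition spi :: "'a tree \<Rightarrow> nat" where
  "spi t = (if \<exists>v w. right_child t v w
            then (LEAST i. i < size t \<and> (\<exists>v. right_child t v (preorder t ! i)))
            else size t)"

definition rspi :: "'a tree \<Rightarrow> nat" where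
  "rspi t = (if \<exists>v w. right_child t v w
             then (LEAST i. i < size t \<and> (\<exists>w. right_child t (rev_preorder t ! i) w))
             else size t)"

text \<open>A path of right edges is given by the list of its nodes, from top to bottom.\<close>

definition right_path :: "'a tree \<Rightarrow> 'a list \<Rightarrow> bool" where
  "right_path t p \<longleftrightarrow> p \<noteq> [] \<and> set p \<subseteq> set_tree t \<and> successively (right_child t) p"

definition right_chain :: "'a tree \<Rightarrow> 'a list \<Rightarrow> bool" where
  "right_chain t p \<longleftrightarrow> right_path t p \<and> (\<forall>q. right_path t q \<and> sublist p q \<longrightarrow> q = p)"

definition right_chain_seq :: "'a tree \<Rightarrow> nat multiset" where
  "right_chain_seq t = image_mset (\<lambda>p. length p - 1) (mset_set {p. right_chain t p})"

text \<open>
  \<open>theta_shape t s\<close>: \<open>s\<close> is the tree \<open>\<vartheta>(t)\<close> before relabelling, i.e. each node still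
  carries its label in \<open>t\<close>. For a nonempty tree with distinct labels there is exactly one such \<open>s\<close>.
\<close>

definition theta_shape :: "'a tree \<Rightarrow> 'a tree \<Rightarrow> bool" where
  "theta_shape t s \<longleftrightarrow>
     (let n = size t; v = (\<lambda>i. preorder t ! (i - 1)) in
        set_tree s = set_tree t \<and> distinct (preorder s) \<and>
        s \<noteq> Leaf \<and> value s = v n \<and>
        (\<forall>i\<in>{1..<n}.
           if \<exists>w. right_child t (v i) w
           then \<forall>w. right_child t (v i) w \<longrightarrow> right_child s w (v i)
           else left_child s (v (i + 1)) (v i)))"

definition theta :: "nat tree \<Rightarrow> nat tree" where
  "theta t = map_tree (\<lambda>x. size t + 1 - x) (THE s. theta_shape t s)"

end

(*
  Write S for the tree theta(T) before relabelling. It is characterised by two properties: its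
  preorder is the reversed preorder of T, and its right edges are the right edges of T turned
  upside down. Both are symmetric in T and S, whence the involution. Turning the right edges
  around reverses every right chain, and the reverse preorder is the preorder read backwards,
  so the (i+1)-th node of S in preorder is a right child iff the (i+1)-th node of T in reverse
  preorder has a right child.
*)
theory Submission
  imports Defs
begin

section \<open>Child relations in trees with distinct labels\<close>

lemma left_child_simps [simp]:
  "\<not> left_child Leaf v w"
  "left_child (Node l x r) v w \<longleftrightarrow>
     v = x \<and> l \<noteq> Leaf \<and> w = value l \<or> left_child l v w \<or> left_child r v w"
proof -
  have "(\<exists>a b. l = Node a w b) \<longleftrightarrow> l \<noteq> Leaf \<and> w = value l"
    by (cases l) auto
  moreover have "left_child (Node l x r) v w \<longleftrightarrow>
      v = x \<and> (\<exists>a b. l = Node a w b) \<or> left_child l v w \<or> left_child r v w"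
    unfolding left_child_def by (simp add: ex_disj_distrib) blast
  ultimately show "left_child (Node l x r) v w \<longleftrightarrow>
      v = x \<and> l \<noteq> Leaf \<and> w = value l \<or> left_child l v w \<or> left_child r v w"
    by blast
qed (simp add: left_child_def)

lemma right_child_simps [simp]:
  "\<not> right_child Leaf v w"
  "right_child (Node l x r) v w \<longleftrightarrow>
     v = x \<and> r \<noteq> Leaf \<and> w = value r \<or> right_child l v w \<or> right_child r v w"
proof -
  have "(\<exists>a b. r = Node a w b) \<longleftrightarrow> r \<noteq> Leaf \<and> w = value r"
    by (cases r) auto
  moreover have "right_child (Node l x r) v w \<longleftrightarrow>
      v = x \<and> (\<exists>a b. r = Node a w b) \<or> right_child l v w \<or> right_child r v w"
    unfolding right_child_def by (simp add: ex_disj_distrib) blast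
  ultimately show "right_child (Node l x r) v w \<longleftrightarrow>
      v = x \<and> r \<noteq> Leaf \<and> w = value r \<or> right_child l v w \<or> right_child r v w"
    by blast
qed (simp add: right_child_def)

lemma value_in_set_tree: "t \<noteq> Leaf \<Longrightarrow> value t \<in> set_tree t"
  by (cases t) auto

lemma nth_0_preorder: "t \<noteq> Leaf \<Longrightarrow> preorder t ! 0 = value t"
  by (cases t) auto

lemma left_child_in_set_tree:
  "left_child t v w \<Longrightarrow> v \<in> set_tree t \<and> w \<in> set_tree t"
  by (induction t) (auto simp: value_in_set_tree)

lemma right_child_in_set_tree:
  "right_child t v w \<Longrightarrow> v \<in> set_tree t \<and> w \<in> set_tree t"
  by (induction t) (auto simp: value_in_set_tree)

lemma left_child_not_root:
  "distinct (preorder t) \<Longrightarrow> left_child t v w \<Longrightarrow> w \<noteq> value t"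
  by (cases t) (auto dest: left_child_in_set_tree value_in_set_tree)

lemma right_child_not_root:
  "distinct (preorder t) \<Longrightarrow> right_child t v w \<Longrightarrow> w \<noteq> value t"
  by (cases t) (auto dest: right_child_in_set_tree value_in_set_tree)

text \<open>By distinctness the two subtrees of a node share no label, and their roots have no
  parent inside them. So two edges into the same node cannot arise at different places.\<close>

lemma left_child_unique:
  "distinct (preorder t) \<Longrightarrow> left_child t v w \<Longrightarrow> left_child t v' w \<Longrightarrow> v = v'"
  by (induction t)
    (auto dest: left_child_in_set_tree left_child_not_root value_in_set_tree)

lemma right_child_unique:
  "distinct (preorder t) \<Longrightarrow> right_child t v w \<Longrightarrow> right_child t v' w \<Longrightarrow> v = v'"
  by (induction t)
    (auto dest: right_child_in_set_tree right_child_not_root value_in_set_tree)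

lemma left_child_not_right_child:
  "distinct (preorder t) \<Longrightarrow> left_child t v w \<Longrightarrow> \<not> right_child t v' w"
proof (induction t)
  case (Node l x r)
  then show ?case
    using value_in_set_tree[of l] value_in_set_tree[of r] left_child_not_root[of l v w]
      left_child_not_root[of r v w] right_child_not_root[of l v' w] right_child_not_root[of r v' w]
    by (auto dest: left_child_in_set_tree right_child_in_set_tree)
qed simp

section \<open>Trees determined by their edges; uniqueness in \<open>theta_shape\<close>\<close>

lemma subtree_in_set_tree: "Node l x r \<in> subtrees t \<Longrightarrow> x \<in> set_tree t"
  by (induction t) auto

lemma subtree_unique:
  "distinct (preorder t) \<Longrightarrow> Node l x r \<in> subtrees t \<Longrightarrow> Node l' x r' \<in> subtrees t \<Longrightarrow>
   Node l x r = Node l' x r'"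
  by (induction t) (auto dest: subtree_in_set_tree)

lemma children_in_subtrees:
  "Node l x r \<in> subtrees t \<Longrightarrow> l \<in> subtrees t \<and> r \<in> subtrees t"
proof (induction t)
  case (Node a y b)
  have "a \<in> subtrees a" "b \<in> subtrees b"
    by (cases a; simp) (cases b; simp)
  with Node show ?case
    by auto
qed simp

lemma left_child_of_subtree:
  assumes "distinct (preorder t)" "Node l x r \<in> subtrees t"
  shows "left_child t x y \<longleftrightarrow> l \<noteq> Leaf \<and> value l = y"
proof
  assume "left_child t x y"
  then obtain l1 r1 r' where "Node (Node l1 y r1) x r' \<in> subtrees t"
    unfolding left_child_def by blast
  from subtree_unique[OF assms this] show "l \<noteq> Leaf \<and> value l = y"
    by simp
next
  assume "l \<noteq> Leaf \<and> value l = y"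
  then obtain l1 r1 where "l = Node l1 y r1"
    by (cases l) auto
  with assms(2) show "left_child t x y"
    unfolding left_child_def by blast
qed

lemma right_child_of_subtree:
  assumes "distinct (preorder t)" "Node l x r \<in> subtrees t"
  shows "right_child t x y \<longleftrightarrow> r \<noteq> Leaf \<and> value r = y"
proof
  assume "right_child t x y"
  then obtain l' l1 r1 where "Node l' x (Node l1 y r1) \<in> subtrees t"
    unfolding right_child_def by blast
  from subtree_unique[OF assms this] show "r \<noteq> Leaf \<and> value r = y"
    by simp
next
  assume "r \<noteq> Leaf \<and> value r = y"
  then obtain l1 r1 where "r = Node l1 y r1"
    by (cases r) auto
  with assms(2) show "right_child t x y"
    unfolding right_child_def by blast
qed

lemma subtrees_self: "t \<in> subtrees t"
  by (cases t) auto

text \<open>The edges at a node fix which children exist and their labels, so the tree can be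
  rebuilt downwards from its root. The root must be given: one-node trees have no edges to tell them
  apart.\<close>

lemma tree_eq_if_same_edges:
  assumes "distinct (preorder s)" "distinct (preorder t)"
    and left: "\<And>v w. left_child s v w \<longleftrightarrow> left_child t v w"
    and right: "\<And>v w. right_child s v w \<longleftrightarrow> right_child t v w"
    and "s \<noteq> Leaf" "t \<noteq> Leaf" "value s = value t"
  shows "s = t"
proof -
  have "u = u'" if "u \<in> subtrees s" "u' \<in> subtrees t" "u \<noteq> Leaf" "u' \<noteq> Leaf" "value u = value u'"
    for u u'
    using that
  proof (induction u arbitrary: u')
    case (Node l x r)
    then obtain l' x' r' where u': "u' = Node l' x' r'"
      by (cases u') auto
    note in_s = children_in_subtrees[OF Node.prems(1)]
    note in_t = children_in_subtrees[OF Node.prems(2)[unfolded u']]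
    note s = left_child_of_subtree[OF assms(1) Node.prems(1)]
      right_child_of_subtree[OF assms(1) Node.prems(1)]
    note t = left_child_of_subtree[OF assms(2) Node.prems(2)[unfolded u']]
      right_child_of_subtree[OF assms(2) Node.prems(2)[unfolded u']]
    have x: "x = x'"
      using Node.prems(5) u' by simp
    \<comment> \<open>If one of \<open>l\<close>, \<open>l'\<close> is nonempty, its root is a left
      child of \<open>x\<close>; by \<open>left\<close> the other one is nonempty with the same
      root, and the induction hypothesis applies.\<close>
    have "l = l'"
      using Node.IH(1)[of l'] in_s in_t left[of x] s(1) t(1) x by metis
    moreover have "r = r'"
      using Node.IH(2)[of r'] in_s in_t right[of x] s(2) t(2) x by metis
    ultimately show ?case
      by (simp add: u' x)
  qed simp
  then show ?thesis
    using assms subtrees_self by blast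
qed

text \<open>A left child directly follows its parent. After a node without left child comes the root
  of a right subtree, either its own or an ancestor's. This recovers left edges from the preorder
  and the right edges.\<close>

lemma consecutive_preorder:
  "Suc i < size t \<Longrightarrow>
   left_child t (preorder t ! i) (preorder t ! Suc i) \<or> (\<exists>u. right_child t u (preorder t ! Suc i))"
proof (induction t arbitrary: i)
  case (Node l x r)
  show ?case
  proof (cases i)
    case 0
    with Node.prems show ?thesis
      by (cases "l = Leaf"; cases "r = Leaf") (auto simp: nth_append nth_0_preorder)
  next
    case (Suc j)
    \<comment> \<open>Past the root, \<open>j\<close> indexes
      \<open>preorder l @ preorder r\<close>: both nodes lie in \<open>l\<close>, or the last node
      of \<open>l\<close> meets the root of \<open>r\<close>, or both lie in
      \<open>r\<close>.\<close>
    consider "Suc j < size l" | "Suc j = size l" "r \<noteq> Leaf" |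
      k where "j = size l + k" "Suc k < size r"
    proof (cases "j < size l")
      case True
      with that Suc Node.prems show ?thesis
        by (cases "r = Leaf") fastforce+
    next
      case False
      then obtain k where "j = size l + k"
        using le_Suc_ex not_less by blast
      with that(3) Suc Node.prems show ?thesis
        by simp
    qed
    then show ?thesis
    proof cases
      case 1
      with Node.IH(1)[of j] Suc show ?thesis
        by (auto simp: nth_append)
    next
      case 2
      with Suc show ?thesis
        by (auto simp: nth_append nth_0_preorder)
    next
      case 3
      with Node.IH(2)[of k] Suc show ?thesis
        by (auto simp: nth_append)
    qed
  qed
qed simp

text \<open>Each non-root node of \<open>s\<close> is some \<open>?v i\<close> with
  \<open>i < size t\<close>, and the clause for \<open>i\<close> gives it a parent in
  \<open>s\<close>. Parent and side are unique, so the given edge is that one; the clause depends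
  only on \<open>t\<close>, so \<open>s'\<close> has the edge too.\<close>

lemma theta_shape_same_edges:
  assumes s: "theta_shape t s" and s': "theta_shape t s'"
  shows "left_child s v w \<Longrightarrow> left_child s' v w"
    and "right_child s v w \<Longrightarrow> right_child s' v w"
proof -
  let ?v = "\<lambda>i. preorder t ! (i - 1)"
  have dist: "distinct (preorder s)"
    using s by (simp add: theta_shape_def Let_def)
  have index: "\<exists>i\<in>{1..<size t}. w = ?v i" if "w \<in> set_tree s" "w \<noteq> value s"
  proof -
    have "w \<in> set (preorder t)"
      using that s by (simp add: theta_shape_def Let_def)
    then obtain j where j: "j < size t" "w = preorder t ! j"
      unfolding in_set_conv_nth by auto
    \<comment> \<open>The root of \<open>s\<close> is the last node of \<open>t\<close> in preorder.
      The 0-based position \<open>j\<close> is the 1-based index \<open>Suc j\<close>.\<close>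
    moreover have "w \<noteq> preorder t ! (size t - 1)"
      using that s by (simp add: theta_shape_def Let_def)
    ultimately have "j \<noteq> size t - 1"
      by blast
    with j have "Suc j \<in> {1..<size t}" "w = ?v (Suc j)"
      by simp_all
    then show ?thesis
      by blast
  qed
  have edge: "if \<exists>y. right_child t (?v i) y
              then \<forall>y. right_child t (?v i) y \<longrightarrow> right_child u y (?v i)
              else left_child u (?v (i + 1)) (?v i)"
    if "theta_shape t u" "i \<in> {1..<size t}" for u i
    using that unfolding theta_shape_def Let_def by blast
  show "left_child s' v w" if *: "left_child s v w"
  proof -
    obtain i where "i \<in> {1..<size t}" "w = ?v i"
      using index left_child_in_set_tree[OF *] left_child_not_root[OF dist *] by blast
    with edge[OF s, of i] edge[OF s', of i] * show ?thesis
      using left_child_unique[OF dist] left_child_not_right_child[OF dist *]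
      by (metis (no_types, lifting))
  qed
  show "right_child s' v w" if *: "right_child s v w"
  proof -
    obtain i where "i \<in> {1..<size t}" "w = ?v i"
      using index right_child_in_set_tree[OF *] right_child_not_root[OF dist *] by blast
    with edge[OF s, of i] edge[OF s', of i] * show ?thesis
      using right_child_unique[OF dist] left_child_not_right_child[OF dist]
      by (metis (no_types, lifting))
  qed
qed

lemma theta_shape_unique:
  assumes "theta_shape t s" "theta_shape t s'"
  shows "s = s'"
proof (rule tree_eq_if_same_edges)
  show "left_child s v w \<longleftrightarrow> left_child s' v w" for v w
    using theta_shape_same_edges[OF assms] theta_shape_same_edges[OF assms(2,1)] by blast
  show "right_child s v w \<longleftrightarrow> right_child s' v w" for v w
    using theta_shape_same_edges[OF assms] theta_shape_same_edges[OF assms(2,1)] by blast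
qed (use assms in \<open>simp_all add: theta_shape_def Let_def\<close>)

section \<open>Existence: the reversal of a tree\<close>

lemma theta_shapeI:
  assumes "t \<noteq> Leaf" "distinct (preorder t)"
    and pre: "preorder s = rev (preorder t)"
    and right: "\<And>v w. right_child s v w \<longleftrightarrow> right_child t w v"
  shows "theta_shape t s"
proof -
  have set: "set_tree s = set_tree t"
    using arg_cong[OF pre, of set] by simp
  have size: "size s = size t"
    using arg_cong[OF pre, of length] by simp
  have s: "s \<noteq> Leaf"
    using size assms(1) by (cases t) auto
  have pos: "size t > 0"
    using assms(1) by (cases t) auto
  have "left_child s (preorder t ! i) (preorder t ! (i - 1))"
    if i: "1 \<le> i" "i < size t" and no: "\<nexists>w. right_child t (preorder t ! (i - 1)) w" for i
  proof -
    \<comment> \<open>Positions \<open>i\<close> and \<open>i - 1\<close> of \<open>t\<close> become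
      consecutive in \<open>s\<close>, in this order. The second node is not a right child in
      \<open>s\<close>, as it has no right child in \<open>t\<close>, so it is a left child of the
      first.\<close>
    have "preorder s ! (size t - Suc i) = preorder t ! i"
      "preorder s ! Suc (size t - Suc i) = preorder t ! (i - 1)"
      using i by (simp_all add: pre rev_nth Suc_diff_Suc)
    with consecutive_preorder[of "size t - Suc i" s] i no right show ?thesis
      by (auto simp: size)
  qed
  then show ?thesis
    using set s assms pos nth_0_preorder[OF s]
    unfolding theta_shape_def Let_def by (auto simp: pre rev_nth)
qed

text \<open>
  \<open>reverse_onto t a b\<close> is the reversal of \<open>t\<close>, where the root of \<open>t\<close>, which has no children in
  the reversal, receives the left subtree \<open>a\<close> and the right subtree \<open>b\<close>.
  The value at \<^const>\<open>Leaf\<close> lets a node without children act as the left subtree on its own.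
\<close>

fun reverse_onto :: "'a tree \<Rightarrow> 'a tree \<Rightarrow> 'a tree \<Rightarrow> 'a tree" where
  "reverse_onto Leaf a b = a"
| "reverse_onto (Node l x Leaf) a b = reverse_onto l (Node a x b) Leaf"
| "reverse_onto (Node l x (Node l' y r')) a b =
     reverse_onto (Node l' y r') (reverse_onto l Leaf Leaf) (Node a x b)"

definition reversal :: "'a tree \<Rightarrow> 'a tree" where
  "reversal t = reverse_onto t Leaf Leaf"

text \<open>The \<open>Leaf\<close> clause drops \<open>b\<close>, hence the side condition. In the
  last clause the reversed right subtree comes first, then the reversed \<open>l\<close>, then
  \<open>x\<close> with \<open>a\<close> and \<open>b\<close>.\<close>

lemma preorder_reverse_onto:
  "t \<noteq> Leaf \<or> b = Leaf \<Longrightarrow>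
   preorder (reverse_onto t a b) = rev (preorder t) @ preorder a @ preorder b"
  by (induction t a b rule: reverse_onto.induct) auto

text \<open>The last disjunct is the edge by which the root of \<open>t\<close> acquires
  \<open>b\<close>. In the recursive call with \<open>Node a x b\<close> it becomes the edge from
  \<open>y\<close> to \<open>x\<close>, the turned right edge of \<open>t\<close>.\<close>

lemma right_child_reverse_onto:
  "t \<noteq> Leaf \<or> b = Leaf \<Longrightarrow>
   right_child (reverse_onto t a b) v w \<longleftrightarrow>
     right_child t w v \<or> right_child a v w \<or> right_child b v w \<or>
     b \<noteq> Leaf \<and> v = value t \<and> w = value b"
  by (induction t a b rule: reverse_onto.induct) auto

lemma reverse_onto_map_tree:
  "reverse_onto (map_tree f t) (map_tree f a) (map_tree f b) = map_tree f (reverse_onto t a b)"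
  by (induction t a b rule: reverse_onto.induct) auto

lemma preorder_reversal [simp]: "preorder (reversal t) = rev (preorder t)"
  by (simp add: reversal_def preorder_reverse_onto)

lemma right_child_reversal [simp]: "right_child (reversal t) v w \<longleftrightarrow> right_child t w v"
  by (simp add: reversal_def right_child_reverse_onto)

lemma reversal_map_tree: "reversal (map_tree f t) = map_tree f (reversal t)"
  using reverse_onto_map_tree[of f t Leaf Leaf] by (simp add: reversal_def)

lemma set_tree_reversal [simp]: "set_tree (reversal t) = set_tree t"
  using arg_cong[OF preorder_reversal[of t], of set] unfolding set_rev set_preorder .

lemma size_reversal [simp]: "size (reversal t) = size t"
  using arg_cong[OF preorder_reversal[of t], of length] unfolding length_rev length_preorder .

lemma theta_shape_reversal:
  "t \<noteq> Leaf \<Longrightarrow> distinct (preorder t) \<Longrightarrow> theta_shape t (reversal t)"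
  by (rule theta_shapeI) simp_all

text \<open>The hypotheses of \<open>theta_shapeI\<close> are symmetric in both trees, so
  \<open>t\<close> itself satisfies \<open>theta_shape (reversal t)\<close>; uniqueness identifies
  it with the second reversal.\<close>

lemma reversal_reversal:
  assumes "t \<noteq> Leaf" "distinct (preorder t)"
  shows "reversal (reversal t) = t"
proof (rule theta_shape_unique)
  have "reversal t \<noteq> Leaf"
    using assms(1) by (metis size_reversal eq_size_0)
  then show "theta_shape (reversal t) (reversal (reversal t))" "theta_shape (reversal t) t"
    using assms by (auto intro: theta_shape_reversal theta_shapeI)
qed

lemma theta_eq_map_reversal:
  assumes "t \<noteq> Leaf" "distinct (preorder t)"
  shows "theta t = map_tree (\<lambda>x. size t + 1 - x) (reversal t)"
  using the_equality[of "theta_shape t" "reversal t"] theta_shape_reversal[OF assms]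
    theta_shape_unique by (metis theta_def)

section \<open>Right chains and statistics under reversal and relabelling\<close>

lemma rev_preorder_conv_rev: "rev_preorder t = rev (preorder t)"
  by (induction t) auto

lemma right_child_map_tree:
  "right_child (map_tree f t) v w \<longleftrightarrow> (\<exists>a b. right_child t a b \<and> v = f a \<and> w = f b)"
proof (induction t)
  case (Node l x r)
  then show ?case
    by (cases r) auto
qed simp

lemma right_child_map_tree_inj:
  assumes "inj_on f (set_tree t)" "a \<in> set_tree t" "b \<in> set_tree t"
  shows "right_child (map_tree f t) (f a) (f b) \<longleftrightarrow> right_child t a b"
proof
  assume "right_child (map_tree f t) (f a) (f b)"
  then obtain c d where cd: "right_child t c d" "f a = f c" "f b = f d"
    unfolding right_child_map_tree by blast
  then have "a = c" "b = d"
    using right_child_in_set_tree[OF cd(1)] assms by (auto dest: inj_onD)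
  with cd show "right_child t a b"
    by simp
qed (auto simp: right_child_map_tree)

text \<open>Turned edges are traversed from the other end, hence \<open>rev\<close>. Injectivity
  prevents relabelling from merging nodes and thereby creating new right edges.\<close>

lemma right_path_rev_map:
  assumes inj: "inj_on f (set_tree t)"
    and p: "set p \<subseteq> set_tree t"
  shows "right_path (map_tree f (reversal t)) (rev (map f p)) \<longleftrightarrow> right_path t p"
proof -
  have "successively (\<lambda>a b. right_child (map_tree f (reversal t)) (f b) (f a)) p \<longleftrightarrow>
        successively (right_child t) p"
    using p right_child_map_tree_inj[of f "reversal t"] inj
    by (intro successively_cong) auto
  then show ?thesis
    using p by (auto simp: right_path_def successively_map tree.set_map image_mono)
qed

lemma right_path_map_reversalE:
  assumes "inj_on f (set_tree t)" "right_path (map_tree f (reversal t)) q"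
  obtains p where "right_path t p" "q = rev (map f p)"
proof -
  define p where "p = map (inv_into (set_tree t) f) (rev q)"
  have q: "set q \<subseteq> f ` set_tree t"
    using assms(2) by (auto simp: right_path_def tree.set_map)
  then have "rev q = map f p"
    unfolding p_def map_map by (intro map_idI[symmetric]) (auto simp: f_inv_into_f)
  moreover have "set p \<subseteq> set_tree t"
    using q by (auto simp: p_def inv_into_into)
  ultimately show ?thesis
    using that[of p] assms right_path_rev_map[of f t p] by (metis rev_rev_ident)
qed

text \<open>The map \<open>?h\<close> is a bijection between the right paths of the two trees. It
  keeps lengths and respects \<open>sublist\<close> in both directions, so it also matches the
  maximal paths.\<close>

lemma right_chain_seq_map_reversal:
  assumes inj: "inj_on f (set_tree t)"
  shows "right_chain_seq (map_tree f (reversal t)) = right_chain_seq t"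
proof -
  let ?s = "map_tree f (reversal t)" and ?h = "\<lambda>p. rev (map f p)" and ?g = "inv_into (set_tree t) f"
  have g: "map ?g (map f p) = p" if "right_path t p" for p
    using that inj unfolding map_map by (intro map_idI) (auto simp: right_path_def)
  have path: "right_path ?s (?h p) \<longleftrightarrow> right_path t p" if "right_path t p" for p
    using right_path_rev_map[OF inj] that unfolding right_path_def by blast
  \<comment> \<open>Mapping preserves \<open>sublist\<close>; the converse follows by mapping back
    with \<open>?g\<close>.\<close>
  have sub: "sublist (?h p) (?h q) \<longleftrightarrow> sublist p q" if "right_path t p" "right_path t q" for p q
    using map_mono_sublist[of "map f p" "map f q" ?g] g[OF that(1)] g[OF that(2)] map_mono_sublist[of p q f]
    unfolding sublist_rev by argo
  have inj_h: "p = q" if "right_path t p" "right_path t q" "?h p = ?h q" for p q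
    using arg_cong[OF that(3)[unfolded rev_is_rev_conv], of "map ?g"]
    unfolding g[OF that(1)] g[OF that(2)] .
  have chain: "right_chain ?s (?h p) \<longleftrightarrow> right_chain t p" if "right_path t p" for p
  proof
    assume *: "right_chain ?s (?h p)"
    show "right_chain t p"
      unfolding right_chain_def
    proof (intro conjI allI impI that)
      fix q assume "right_path t q \<and> sublist p q"
      then show "q = p"
        using * path[of q] sub[OF that, of q] inj_h[of q p] that unfolding right_chain_def by blast
    qed
  next
    assume *: "right_chain t p"
    show "right_chain ?s (?h p)"
      unfolding right_chain_def
    proof (intro conjI allI impI)
      show "right_path ?s (?h p)"
        using path that by blast
      fix q assume q: "right_path ?s q \<and> sublist (?h p) q"
      then obtain p' where p': "right_path t p'" "q = ?h p'"
        using right_path_map_reversalE[OF inj] by blast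
      then have "p' = p"
        using * q sub[OF that, of p'] unfolding right_chain_def by blast
      with p' show "q = ?h p"
        by simp
    qed
  qed
  have "{q. right_chain ?s q} = ?h ` {p. right_chain t p}"
  proof (intro equalityI subsetI)
    fix q assume q: "q \<in> {q. right_chain ?s q}"
    then have "right_path ?s q"
      by (simp add: right_chain_def)
    then obtain p where "right_path t p" "q = ?h p"
      by (rule right_path_map_reversalE[OF inj])
    with q chain show "q \<in> ?h ` {p. right_chain t p}"
      by simp
  next
    fix q assume "q \<in> ?h ` {p. right_chain t p}"
    then show "q \<in> {q. right_chain ?s q}"
      using chain unfolding right_chain_def[of t] by blast
  qed
  moreover have "inj_on ?h {p. right_chain t p}"
    using inj_h by (intro inj_onI) (auto simp: right_chain_def)
  ultimately show ?thesis
    by (simp add: right_chain_seq_def multiset.map_comp comp_def flip: image_mset_mset_set)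
qed

lemma spi_map_reversal:
  assumes inj: "inj_on f (set_tree t)"
  shows "spi (map_tree f (reversal t)) = rspi t"
proof -
  let ?s = "map_tree f (reversal t)"
  have "(\<exists>v. right_child ?s v (preorder ?s ! i)) \<longleftrightarrow> (\<exists>w. right_child t (rev_preorder t ! i) w)"
    if "i < size t" for i
  proof -
    have nth: "preorder ?s ! i = f (rev_preorder t ! i)"
      using that by (simp add: preorder_map rev_preorder_conv_rev)
    have "rev_preorder t ! i \<in> set_tree t"
      using that nth_mem[of i "rev_preorder t"] by (simp add: rev_preorder_conv_rev)
    then show ?thesis
      unfolding nth right_child_map_tree right_child_reversal
      using inj by (metis inj_on_eq_iff right_child_in_set_tree)
  qed
  \<comment> \<open>Both definitions bound \<open>i\<close> by the size, so agreement at these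
    positions makes the predicates under \<open>LEAST\<close> equal.\<close>
  then have "(\<lambda>i. i < size t \<and> (\<exists>v. right_child ?s v (preorder ?s ! i))) =
             (\<lambda>i. i < size t \<and> (\<exists>w. right_child t (rev_preorder t ! i) w))"
    by (intro ext conj_cong refl)
  \<comment> \<open>This matches the convention for trees without right edges.\<close>
  moreover have "(\<exists>v w. right_child ?s v w) \<longleftrightarrow> (\<exists>v w. right_child t v w)"
    by (auto simp: right_child_map_tree)
  moreover have "size ?s = size t"
    by simp
  ultimately show ?thesis
    unfolding spi_def rspi_def by (simp only:)
qed

section \<open>The map \<open>theta\<close> on \<open>RB n\<close>\<close>

lemma theta_on_RB:
  assumes "n \<ge> 1" "T \<in> RB n"
  shows theta_conv_reversal: "theta T = map_tree (\<lambda>x. n + 1 - x) (reversal T)"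
    and theta_in_RB: "theta T \<in> RB n"
    and theta_theta: "theta (theta T) = T"
proof -
  let ?f = "\<lambda>x. n + 1 - x"
  have conv: "theta t = map_tree ?f (reversal t)" and nonempty: "t \<noteq> Leaf" if "t \<in> RB n" for t
  proof -
    have t: "set (preorder t) = {1..n}" "distinct (preorder t)"
      using that by (auto simp: RB_def)
    show "t \<noteq> Leaf"
      using t assms(1) by auto
    moreover have "size t = n"
      using distinct_card[OF t(2)] unfolding t(1) by simp
    ultimately show "theta t = map_tree ?f (reversal t)"
      using theta_eq_map_reversal t(2) by blast
  qed
  from conv[OF assms(2)] show T: "theta T = map_tree ?f (reversal T)" .
  have inj: "inj_on ?f {1..n}"
    by (rule inj_onI) auto
  have "?f ` {1..n} = {1..n}"
    using inj by (intro endo_inj_surj) auto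
  \<comment> \<open>Reversal swaps parent and child along right edges and \<open>?f\<close> reverses
    the order of labels, so right children stay greater.\<close>
  then show RB: "theta T \<in> RB n"
    using assms(2) inj unfolding T RB_def
    by (auto simp: tree.set_map preorder_map distinct_map right_child_map_tree
        intro!: diff_less_mono2 dest: right_child_in_set_tree)
  \<comment> \<open>Reversal commutes with relabelling, so the two reversals meet and cancel,
    leaving \<open>?f\<close> applied twice, the identity on \<open>{1..n}\<close>.\<close>
  have "theta (theta T) = map_tree ?f (map_tree ?f (reversal (reversal T)))"
    unfolding conv[OF RB] unfolding T reversal_map_tree ..
  also have "reversal (reversal T) = T"
    using assms(2) by (intro reversal_reversal nonempty) (simp_all add: RB_def)
  also have "map_tree ?f (map_tree ?f T) = T"
    unfolding tree.map_comp
    using assms(2) by (intro tree.map_ident_strong) (auto simp: RB_def)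
  finally show "theta (theta T) = T" .
qed

theorem theorem3p14:
  fixes n :: nat
  assumes "n \<ge> 1"
  shows "(\<forall>T \<in> RB n. theta T \<in> RB n) \<and>
         (\<forall>T \<in> RB n. theta (theta T) = T) \<and>
         (\<forall>T \<in> RB n. right_chain_seq (theta T) = right_chain_seq T) \<and>
         (\<forall>T \<in> RB n. spi (theta T) = rspi T \<and> rspi (theta T) = spi T)"
proof -
  have inj: "inj_on (\<lambda>x. n + 1 - x) (set_tree T)" if "T \<in> RB n" for T
    using that by (auto simp: RB_def intro!: inj_onI)
  have "right_chain_seq (theta T) = right_chain_seq T" "spi (theta T) = rspi T" if "T \<in> RB n" for T
    using theta_conv_reversal[OF assms that] inj[OF that]
    by (simp_all only: right_chain_seq_map_reversal spi_map_reversal)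
  \<comment> \<open>The equation for \<open>rspi (theta T)\<close> is the one for \<open>spi\<close>
    taken at \<open>theta T\<close>, combined with the involution.\<close>
  then show ?thesis
    using theta_in_RB[OF assms] theta_theta[OF assms] by metis
qed

end
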